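(* Let $f:\mathbb{R}^n\times\mathbb{R}_{\ge 0}\to\mathbb{R}$ satisfy the strong convexity condition with constant $m>0$, the Lipschitz gradient condition with constant $M>0$, and the smoothness condition with constants $K_1,K_2,K_3\ge 0$ (all stated in the context). Let $\epsilon>0$, $\delta>0$, $t_0\ge 0$, $t_k=t_0+k\delta$, $\mathbf{x}_0\in\mathbb{R}^n$, and $0<\alpha\le \frac{1}{2M}$, and let $(\mathbf{x}_k)_{k\ge 0}$ be the sequence generated by Algorithm 3 (described in the context). Put $f_3(t_k)=f(\mathbf{x}_k,t_k)$. Then for every integer $k\ge 1$, $$f_3(t_{k+1})-f^\star(t_{k+1})\le (1-2\kappa\alpha m)^k\,\big(f_3(t_0)-f^\star(t_0)\big)+\big(1-(1-2\kappa\alpha m)^k\big)E_3,$$ where $$E_3=\frac{\psi}{4\kappa^2\alpha^2 m}+\frac{\max(\gamma\delta^2,\mu\delta,\eta\delta^2)}{4\kappa^2\alpha^2m^2},\qquad \psi=\delta\Big(K_1+\frac{\delta}{2}K_3\Big)+\frac{K_2^2\delta^2}{2m}\Big(\frac{M\delta}{m}+2\Big),$$ $$\eta=\frac{2}{\delta}K_1+\frac12K_3+\frac{2}{\epsilon}K_1K_2+\frac{M}{2\epsilon^2}K_1^2,\qquad \mu=K_1+\frac{\delta}{2}K_3,$$ $$\gamma=\frac{2}{\delta}K_1+\frac{M}{2\epsilon^2}K_1^2+\frac12K_3+\frac1\epsilon K_1K_2,\qquad \kappa=1-\frac{\alpha M}{2}.$$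
   Context: Notation: $\|\cdot\|$ is the Euclidean norm; $\nabla_{\mathbf{x}}f$, $\nabla_t f$, $\nabla_{\mathbf{x}t}f$, $\nabla_{tt}f$ denote partial derivatives of first and second order. $\mathbf{x}^\star(t)$ is the unique global minimizer of $\mathbf{x}\mapsto f(\mathbf{x},t)$ and $f^\star(t)=f(\mathbf{x}^\star(t),t)$. Strong convexity condition: $f$ is twice continuously differentiable in $\mathbf{x}$ and, for all $t\ge0$ and all $\mathbf{x},\mathbf{z}\in\mathbb{R}^n$, $m\|\mathbf{z}-\mathbf{x}\|^2\le(\mathbf{z}-\mathbf{x})^\top(\nabla_{\mathbf{x}}f(\mathbf{z},t)-\nabla_{\mathbf{x}}f(\mathbf{x},t))$. Lipschitz gradient condition: $f$ is twice differentiable in $\mathbf{x}$ and, for all $t\ge0$ and all $\mathbf{x},\mathbf{z}\in\mathbb{R}^n$, $(\mathbf{z}-\mathbf{x})^\top(\nabla_{\mathbf{x}}f(\mathbf{z},t)-\nabla_{\mathbf{x}}f(\mathbf{x},t))\le M\|\mathbf{z}-\mathbf{x}\|^2$. Smoothness condition: $f$ is continuously differentiable and sufficiently smooth (meaning here twice continuously differentiable jointly in $(\mathbf{x},t)$), with $|\nabla_tf(\mathbf{x},t)|\le K_1$, $\|\nabla_{\mathbf{x}t}f(\mathbf{x},t)\|\le K_2$, $|\nabla_{tt}f(\mathbf{x},t)|\le K_3$ for all $\mathbf{x}\in\mathbb{R}^n$, $t\ge0$. Algorithm 3: given $\mathbf{x}_k$, abbreviate $g=\nabla_{\mathbf{x}}f(\mathbf{x}_k,t_k)$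 and $h=\nabla_{\mathbf{x}t}f(\mathbf{x}_k,t_k)$. The prediction is: (i) if $\|g+\delta h\|\ge\epsilon$ and $h^\top g\le 0$, then $\mathbf{x}^-_{k+1}=\mathbf{x}_k-\frac{\delta|\nabla_tf(\mathbf{x}_k,t_k)|}{\|g+\delta h\|^2}(g+\delta h)$; (ii) else if $\|g\|\ge\epsilon$, then $\mathbf{x}^-_{k+1}=\mathbf{x}_k-\delta\frac{|\nabla_tf(\mathbf{x}_k,t_k)|}{\|g\|^2}g$; (iii) else $\mathbf{x}^-_{k+1}=\mathbf{x}_k$. The update is $\mathbf{x}_{k+1}=\mathbf{x}^-_{k+1}-\alpha\nabla_{\mathbf{x}}f(\mathbf{x}^-_{k+1},t_{k+1})$. *)

theory Defs
  imports "HOL-Analysis.Analysis"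
begin

text \<open>
  The objective is a curried total function \<open>f x t\<close>; only its values for \<open>t \<ge> 0\<close> matter, and
  derivatives with respect to \<open>t\<close> are taken within \<open>{0..}\<close>, hence one-sided at \<open>t = 0\<close>.
\<close>

definition grad :: "('a::real_inner \<Rightarrow> real) \<Rightarrow> 'a \<Rightarrow> 'a" where
  "grad F x = (THE D. GDERIV F x :> D)"

definition nabla_x :: "('a::real_inner \<Rightarrow> real \<Rightarrow> real) \<Rightarrow> 'a \<Rightarrow> real \<Rightarrow> 'a" where
  "nabla_x f x t = grad (\<lambda>y. f y t) x"

definition nabla_t :: "('a \<Rightarrow> real \<Rightarrow> real) \<Rightarrow> 'a \<Rightarrow> real \<Rightarrow> real" where
  "nabla_t f x t = vector_derivative (\<lambda>s. f x s) (at t within {0..})"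

definition nabla_xt :: "('a::real_inner \<Rightarrow> real \<Rightarrow> real) \<Rightarrow> 'a \<Rightarrow> real \<Rightarrow> 'a" where
  "nabla_xt f x t = vector_derivative (\<lambda>s. nabla_x f x s) (at t within {0..})"

definition nabla_tt :: "('a \<Rightarrow> real \<Rightarrow> real) \<Rightarrow> 'a \<Rightarrow> real \<Rightarrow> real" where
  "nabla_tt f x t = vector_derivative (\<lambda>s. nabla_t f x s) (at t within {0..})"

text \<open>
  All derivatives are Frechet derivatives within \<open>S\<close>. The sets used below are the whole space and
  the closed half-space \<open>UNIV \<times> {0..}\<close>, on which these derivatives are unique.
\<close>

definition twice_diff_on :: "'a::real_normed_vector set \<Rightarrow> ('a \<Rightarrow> real) \<Rightarrow> bool" where
  "twice_diff_on S F \<longleftrightarrow>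
     (\<exists>(F' :: 'a \<Rightarrow> 'a \<Rightarrow>\<^sub>L real) (F'' :: 'a \<Rightarrow> 'a \<Rightarrow>\<^sub>L ('a \<Rightarrow>\<^sub>L real)).
        (\<forall>z\<in>S. (F has_derivative blinfun_apply (F' z)) (at z within S)) \<and>
        (\<forall>z\<in>S. (F' has_derivative blinfun_apply (F'' z)) (at z within S)))"

definition twice_cont_diff_on :: "'a::real_normed_vector set \<Rightarrow> ('a \<Rightarrow> real) \<Rightarrow> bool" where
  "twice_cont_diff_on S F \<longleftrightarrow>
     (\<exists>(F' :: 'a \<Rightarrow> 'a \<Rightarrow>\<^sub>L real) (F'' :: 'a \<Rightarrow> 'a \<Rightarrow>\<^sub>L ('a \<Rightarrow>\<^sub>L real)).
        (\<forall>z\<in>S. (F has_derivative blinfun_apply (F' z)) (at z within S)) \<and>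
        (\<forall>z\<in>S. (F' has_derivative blinfun_apply (F'' z)) (at z within S)) \<and>
        continuous_on S F'')"

definition strong_convexity :: "('a::real_inner \<Rightarrow> real \<Rightarrow> real) \<Rightarrow> real \<Rightarrow> bool" where
  "strong_convexity f m \<longleftrightarrow>
     (\<forall>t\<ge>0. twice_cont_diff_on UNIV (\<lambda>x. f x t)) \<and>
     (\<forall>t\<ge>0. \<forall>x z. m * (norm (z - x))\<^sup>2 \<le> (z - x) \<bullet> (nabla_x f z t - nabla_x f x t))"

definition lipschitz_gradient :: "('a::real_inner \<Rightarrow> real \<Rightarrow> real) \<Rightarrow> real \<Rightarrow> bool" where
  "lipschitz_gradient f M \<longleftrightarrow>
     (\<forall>t\<ge>0. twice_diff_on UNIV (\<lambda>x. f x t)) \<and>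
     (\<forall>t\<ge>0. \<forall>x z. (z - x) \<bullet> (nabla_x f z t - nabla_x f x t) \<le> M * (norm (z - x))\<^sup>2)"

definition smoothness ::
  "('a::real_inner \<Rightarrow> real \<Rightarrow> real) \<Rightarrow> real \<Rightarrow> real \<Rightarrow> real \<Rightarrow> bool" where
  "smoothness f K1 K2 K3 \<longleftrightarrow>
     twice_cont_diff_on (UNIV \<times> {0..}) (\<lambda>(x, t). f x t) \<and>
     (\<forall>x. \<forall>t\<ge>0. \<bar>nabla_t f x t\<bar> \<le> K1 \<and> norm (nabla_xt f x t) \<le> K2 \<and> \<bar>nabla_tt f x t\<bar> \<le> K3)"

definition xstar :: "('a \<Rightarrow> real \<Rightarrow> real) \<Rightarrow> real \<Rightarrow> 'a" where
  "xstar f t = (THE x. \<forall>y. f x t \<le> f y t)"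

definition fstar :: "('a \<Rightarrow> real \<Rightarrow> real) \<Rightarrow> real \<Rightarrow> real" where
  "fstar f t = f (xstar f t) t"

definition predict ::
  "('a::real_inner \<Rightarrow> real \<Rightarrow> real) \<Rightarrow> real \<Rightarrow> real \<Rightarrow> real \<Rightarrow> 'a \<Rightarrow> 'a" where
  "predict f \<epsilon> \<delta> t x =
     (let g = nabla_x f x t; h = nabla_xt f x t in
      if norm (g + \<delta> *\<^sub>R h) \<ge> \<epsilon> \<and> h \<bullet> g \<le> 0
      then x - (\<delta> * \<bar>nabla_t f x t\<bar> / (norm (g + \<delta> *\<^sub>R h))\<^sup>2) *\<^sub>R (g + \<delta> *\<^sub>R h)
      else if norm g \<ge> \<epsilon>
      then x - (\<delta> * \<bar>nabla_t f x t\<bar> / (norm g)\<^sup>2) *\<^sub>R g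
      else x)"

definition gradient_step ::
  "('a::real_inner \<Rightarrow> real \<Rightarrow> real) \<Rightarrow> real \<Rightarrow> real \<Rightarrow> 'a \<Rightarrow> 'a" where
  "gradient_step f \<alpha> t x = x - \<alpha> *\<^sub>R nabla_x f x t"

text \<open>
  A run of the prediction-correction algorithm along the sampling times \<open>\<tau> k\<close> with period \<open>\<delta>\<close>.
\<close>

definition algorithm3 ::
  "('a::real_inner \<Rightarrow> real \<Rightarrow> real) \<Rightarrow> real \<Rightarrow> real \<Rightarrow> real \<Rightarrow> (nat \<Rightarrow> real) \<Rightarrow> (nat \<Rightarrow> 'a) \<Rightarrow> bool" where
  "algorithm3 f \<epsilon> \<delta> \<alpha> \<tau> x \<longleftrightarrow>
     (\<forall>k. x (Suc k) = gradient_step f \<alpha> (\<tau> (Suc k)) (predict f \<epsilon> \<delta> (\<tau> k) (x k)))"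

end

theory Submission
  imports Defs
begin

text \<open>
  Write \<open>e\<^sub>k = f x\<^sub>k t\<^sub>k - f\<^sup>\<star> t\<^sub>k\<close> for the optimality gap and \<open>\<rho> = 1 - 2\<kappa>\<alpha>m\<close>. The proof is a
  one-step recursion \<open>e\<^sub>k\<^sub>+\<^sub>1 \<le> \<rho> (e\<^sub>k + Q)\<close> with \<open>Q = max (\<gamma>\<delta>\<^sup>2) (\<mu>\<delta>) (\<eta>\<delta>\<^sup>2)\<close>, followed by a
  comparison of a geometric sum with \<open>Q / (1 - \<rho>)\<^sup>2\<close>.

  The factor \<open>\<rho>\<close> comes from the gradient step: by the descent lemma it lowers the value by
  \<open>\<kappa>\<alpha>\<close> times the squared gradient norm, which by the Polyak-Lojasiewicz inequality is at least
  \<open>2m\<close> times the gap (\<open>gradient_step_contraction\<close>). Before the gradient step the gap has grown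
  in two ways. The optimal value drops by at most \<open>K1 \<delta>\<close>, because it is an infimum of functions
  that are \<open>K1\<close>-Lipschitz in time (\<open>fstar_drift\<close>). The prediction together with the passage of time
  costs at most \<open>\<eta>\<delta>\<^sup>2 - K1 \<delta>\<close> (\<open>prediction_cost\<close>): if the point moves, its displacement is
  scaled such that the first-order decrease in space cancels the first-order increase
  \<open>\<delta> \<bar>\<nabla>\<^sub>t f\<bar>\<close> in time, and only terms of order \<open>\<delta>\<^sup>2\<close> survive; if it stays, the cost is
  at most \<open>K1 \<delta>\<close>. Since \<open>\<eta>\<delta>\<^sup>2\<close> contains the summand \<open>2 K1 \<delta>\<close>, it absorbs both contributions, so
  the whole growth is at most \<open>Q\<close>.

  Unrolling gives \<open>e\<^sub>k\<^sub>+\<^sub>1 \<le> \<rho>\<^sup>k\<^sup>+\<^sup>1 e\<^sub>0 + \<rho> (1 - \<rho>\<^sup>k\<^sup>+\<^sup>1) / (1 - \<rho>) Q\<close>. As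
  \<open>(1 - \<rho>)\<^sup>2 = 4\<kappa>\<^sup>2\<alpha>\<^sup>2m\<^sup>2\<close>, the number \<open>Q / (1 - \<rho>)\<^sup>2\<close> is the second summand of \<open>E3\<close>. The first
  is nonnegative, and \<open>geometric_weight_bound\<close> shows that the weight \<open>1 - \<rho>\<^sup>k\<close> of \<open>E3\<close> in the
  theorem is large enough.
\<close>

section \<open>Quadratic bounds from monotonicity of the gradient\<close>

text \<open>
  Along the segment from \<open>x\<close> to \<open>y\<close>, left-hand minus right-hand side has nonpositive derivative.
  Derivatives are taken within a convex set, so that the lemma covers the half-line of
  times as well as the whole space; with \<open>-F\<close>, \<open>-G\<close> and \<open>-c\<close> it yields the
  corresponding lower bound.
\<close>

lemma quadratic_upper_bound:
  fixes F :: "'a::real_inner \<Rightarrow> real"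
  assumes "convex S" and x: "x \<in> S" and y: "y \<in> S"
    and der: "\<And>z. z \<in> S \<Longrightarrow> (F has_derivative (\<lambda>v. G z \<bullet> v)) (at z within S)"
    and mono: "\<And>z. z \<in> S \<Longrightarrow> (z - x) \<bullet> (G z - G x) \<le> c * (norm (z - x))\<^sup>2"
  shows "F y \<le> F x + G x \<bullet> (y - x) + c / 2 * (norm (y - x))\<^sup>2"
proof -
  define d where "d = y - x"
  define p where "p \<theta> = x + \<theta> *\<^sub>R d" for \<theta> :: real
  define \<phi> where "\<phi> \<theta> = F (p \<theta>) - \<theta> * (G x \<bullet> d) - c / 2 * \<theta>\<^sup>2 * (norm d)\<^sup>2" for \<theta> :: real
  have p_in: "p \<theta> \<in> S" if "\<theta> \<in> {0..1}" for \<theta>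
  proof -
    have "p \<theta> = (1 - \<theta>) *\<^sub>R x + \<theta> *\<^sub>R y"
      by (simp add: p_def d_def algebra_simps)
    then show ?thesis
      using \<open>convex S\<close> x y that by (simp add: convex_alt)
  qed
  have der_F: "((\<lambda>\<theta>. F (p \<theta>)) has_derivative (\<lambda>h. G (p \<theta>) \<bullet> (h *\<^sub>R d))) (at \<theta> within {0..1})"
    if "\<theta> \<in> {0..1}" for \<theta>
  proof (rule has_derivative_in_compose[where f = p])
    show "(p has_derivative (\<lambda>h. h *\<^sub>R d)) (at \<theta> within {0..1})"
      unfolding p_def by (auto intro!: derivative_eq_intros)
    show "(F has_derivative (\<lambda>v. G (p \<theta>) \<bullet> v)) (at (p \<theta>) within p ` {0..1})"
      using der[OF p_in[OF that]] p_in by (auto intro: has_derivative_subset)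
  qed
  have poly: "((\<lambda>\<theta>. \<theta> * (G x \<bullet> d) + c / 2 * \<theta>\<^sup>2 * (norm d)\<^sup>2) has_derivative
      (\<lambda>h. h * (G x \<bullet> d + c * \<theta> * (norm d)\<^sup>2))) (at \<theta> within {0..1})" for \<theta>
    by (auto intro!: derivative_eq_intros simp: fun_eq_iff algebra_simps)
  have "(\<phi> has_derivative (\<lambda>h. h * ((G (p \<theta>) - G x) \<bullet> d - c * \<theta> * (norm d)\<^sup>2)))
      (at \<theta> within {0..1})" if "0 \<le> \<theta>" "\<theta> \<le> 1" for \<theta>
  proof -
    have "((\<lambda>\<theta>. F (p \<theta>) - (\<theta> * (G x \<bullet> d) + c / 2 * \<theta>\<^sup>2 * (norm d)\<^sup>2)) has_derivative
        (\<lambda>h. G (p \<theta>) \<bullet> (h *\<^sub>R d) - h * (G x \<bullet> d + c * \<theta> * (norm d)\<^sup>2))) (at \<theta> within {0..1})"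
      using has_derivative_diff[OF der_F poly] that by simp
    then show ?thesis
      unfolding \<phi>_def by (simp add: algebra_simps inner_diff_left)
  qed
  from mvt_simple[OF zero_less_one this]
  obtain \<theta> where \<theta>: "\<theta> \<in> {0<..<1}"
    and inc: "\<phi> 1 - \<phi> 0 = (G (p \<theta>) - G x) \<bullet> d - c * \<theta> * (norm d)\<^sup>2"
    by auto
  have "\<theta> * ((G (p \<theta>) - G x) \<bullet> d) \<le> \<theta> * (c * \<theta> * (norm d)\<^sup>2)"
    using mono[OF p_in, of \<theta>] \<theta>
    by (simp add: p_def power_mult_distrib power2_eq_square inner_commute ac_simps)
  then have "\<phi> 1 \<le> \<phi> 0"
    using inc \<theta> by simp
  then show ?thesis
    by (simp add: \<phi>_def p_def d_def)
qed

section \<open>Partial derivatives\<close>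

lemma grad_works:
  fixes F :: "'a::euclidean_space \<Rightarrow> real"
  assumes "(F has_derivative D) (at x)"
  shows "(F has_derivative (\<lambda>v. grad F x \<bullet> v)) (at x)"
    and "grad F x = (\<Sum>b\<in>Basis. D b *\<^sub>R b)"
proof -
  define g where "g = (\<Sum>b\<in>Basis. D b *\<^sub>R b)"
  have lin: "linear D"
    using assms has_derivative_linear by blast
  have D_eq: "D = (\<lambda>v. v \<bullet> g)"
  proof
    fix v :: 'a
    have "D v = D (\<Sum>b\<in>Basis. (v \<bullet> b) *\<^sub>R b)"
      by (simp add: euclidean_representation)
    also have "\<dots> = v \<bullet> g"
      by (simp add: linear_sum[OF lin] linear_scale[OF lin] g_def inner_sum_right mult.commute)
    finally show "D v = v \<bullet> g" .
  qed
  have g: "GDERIV F x :> g"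
    using assms D_eq by (simp add: gderiv_def)
  have "D' = g" if "GDERIV F x :> D'" for D'
  proof -
    have "(\<lambda>v. v \<bullet> D') = (\<lambda>v. v \<bullet> g)"
      using has_derivative_unique[OF that[unfolded gderiv_def] g[unfolded gderiv_def]] .
    then have "\<forall>v. v \<bullet> D' = v \<bullet> g"
      by (simp add: fun_eq_iff)
    then show ?thesis
      by (rule vector_eq_ldot[THEN iffD1])
  qed
  with g have grad: "grad F x = g"
    unfolding grad_def by (rule the_equality)
  then show "grad F x = (\<Sum>b\<in>Basis. D b *\<^sub>R b)"
    by (simp add: g_def)
  show "(F has_derivative (\<lambda>v. grad F x \<bullet> v)) (at x)"
    using g grad by (simp add: gderiv_def inner_commute)
qed

lemma time_slice_derivative:
  assumes "(F has_derivative D) (at (x, t) within UNIV \<times> {0::real..})"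
  shows "((\<lambda>s. F (x, s)) has_vector_derivative D (0, 1)) (at t within {0..})"
proof -
  have "((\<lambda>s. F (x, s)) has_derivative (\<lambda>h. D (0, h))) (at t within {0..})"
  proof (rule has_derivative_in_compose[where f = "\<lambda>s. (x, s)"])
    show "((\<lambda>s. (x, s)) has_derivative (\<lambda>h. (0, h))) (at t within {0..})"
      by (auto intro!: derivative_eq_intros)
    show "(F has_derivative D) (at (x, t) within (\<lambda>s. (x, s)) ` {0..})"
      using assms by (rule has_derivative_subset) auto
  qed
  moreover have "(\<lambda>h. D (0, h)) = (\<lambda>h. h *\<^sub>R D (0, 1))"
  proof
    show "D (0, h) = h *\<^sub>R D (0, 1)" for h
      using linear_scale[OF has_derivative_linear[OF assms], of h "(0, 1)"] by simp
  qed
  ultimately show ?thesis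
    by (simp only: has_vector_derivative_def)
qed

lemma space_slice_derivative:
  assumes "(F has_derivative D) (at (x, t) within UNIV \<times> {0::real..})" and "t \<ge> 0"
  shows "((\<lambda>y. F (y, t)) has_derivative (\<lambda>v. D (v, 0))) (at x)"
proof (rule has_derivative_in_compose[where f = "\<lambda>y. (y, t)"])
  show "((\<lambda>y. (y, t)) has_derivative (\<lambda>v. (v, 0))) (at x)"
    by (auto intro!: derivative_eq_intros)
  show "(F has_derivative D) (at (x, t) within (\<lambda>y. (y, t)) ` UNIV)"
    using assms(1) by (rule has_derivative_subset) (use \<open>t \<ge> 0\<close> in auto)
qed

lemma at_within_Ici_neq_bot: "t \<ge> 0 \<Longrightarrow> at t within {0::real..} \<noteq> bot"
proof -
  assume "t \<ge> 0"
  then have "at t within {t..t + 1} \<noteq> bot" and "at t within {t..t + 1} \<le> at t within {0..}"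
    by (auto simp: trivial_limit_within islimpt_Icc intro: at_le)
  then show ?thesis
    using le_bot[of "at t within {t..t + 1}"] by auto
qed

text \<open>
  The operators \<open>nabla_t\<close>, \<open>nabla_tt\<close> and \<open>nabla_xt\<close> are defined by choice, so their bounds say
  something about \<open>f\<close> only if the derivatives exist. This follows from joint smoothness: all of
  them are entries of the first and second Frechet derivatives of \<open>f\<close> on the half-space. The
  mixed derivative arises by differentiating first in space and then in time.
\<close>

lemma partial_derivatives:
  fixes f :: "'a::euclidean_space \<Rightarrow> real \<Rightarrow> real"
  assumes smooth: "twice_cont_diff_on (UNIV \<times> {0..}) (\<lambda>(x, t). f x t)" and t: "t \<ge> 0"
  shows f_time_derivative: "(f x has_vector_derivative nabla_t f x t) (at t within {0..})"
    and nabla_t_time_derivative: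
      "(nabla_t f x has_vector_derivative nabla_tt f x t) (at t within {0..})"
    and nabla_x_time_derivative:
      "(nabla_x f x has_vector_derivative nabla_xt f x t) (at t within {0..})"
proof -
  obtain F' :: "'a \<times> real \<Rightarrow> ('a \<times> real) \<Rightarrow>\<^sub>L real" and F''
    where "\<And>z. z \<in> UNIV \<times> {0..} \<Longrightarrow>
        ((\<lambda>(x, t). f x t) has_derivative blinfun_apply (F' z)) (at z within UNIV \<times> {0..})"
      and "\<And>z. z \<in> UNIV \<times> {0..} \<Longrightarrow>
        (F' has_derivative blinfun_apply (F'' z)) (at z within UNIV \<times> {0..})"
    using smooth unfolding twice_cont_diff_on_def by blast
  then have F': "((\<lambda>(x, t). f x t) has_derivative F' (x, s)) (at (x, s) within UNIV \<times> {0..})"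
    and F'': "(F' has_derivative F'' (x, s)) (at (x, s) within UNIV \<times> {0..})"
    if "s \<ge> 0" for s x
    using that by auto
  have f_t: "(f x has_vector_derivative F' (x, s) (0, 1)) (at s within {0..})" if "s \<ge> 0" for s
    using time_slice_derivative[OF F'[OF that]] by simp
  have nabla_t: "nabla_t f x s = F' (x, s) (0, 1)" if "s \<ge> 0" for s
    unfolding nabla_t_def
    using vector_derivative_within[OF at_within_Ici_neq_bot[OF that] f_t[OF that]] by simp
  have nabla_x: "nabla_x f x s = (\<Sum>b\<in>Basis. F' (x, s) (b, 0) *\<^sub>R b)" if "s \<ge> 0" for s
    unfolding nabla_x_def
    using grad_works(2)[OF space_slice_derivative[OF F'[OF that] that]] by simp
  have F'_t: "((\<lambda>s. F' (x, s)) has_vector_derivative F'' (x, t) (0, 1)) (at t within {0..})"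
    using time_slice_derivative[OF F''[OF t]] .
  have entry: "((\<lambda>s. F' (x, s) w) has_vector_derivative F'' (x, t) (0, 1) w) (at t within {0..})"
    for w
    by (rule bounded_linear.has_vector_derivative[OF _ F'_t]) (rule blinfun.bounded_linear_left)
  show "(f x has_vector_derivative nabla_t f x t) (at t within {0..})"
    using f_t[OF t] nabla_t[OF t] by simp
  have nabla_t_deriv:
    "(nabla_t f x has_vector_derivative F'' (x, t) (0, 1) (0, 1)) (at t within {0..})"
    by (rule has_vector_derivative_transform[OF _ _ entry]) (use t nabla_t in auto)
  then show "(nabla_t f x has_vector_derivative nabla_tt f x t) (at t within {0..})"
    using vector_derivative_within[OF at_within_Ici_neq_bot[OF t] nabla_t_deriv]
    by (simp add: nabla_tt_def)
  have sum_deriv: "((\<lambda>s. \<Sum>b\<in>Basis. F' (x, s) (b, 0) *\<^sub>R b) has_vector_derivative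
      (\<Sum>b\<in>Basis. F'' (x, t) (0, 1) (b, 0) *\<^sub>R b)) (at t within {0..})"
    by (intro has_vector_derivative_sum
        bounded_linear.has_vector_derivative[OF bounded_linear_scaleR_left entry])
  have nabla_x_deriv: "(nabla_x f x has_vector_derivative
      (\<Sum>b\<in>Basis. F'' (x, t) (0, 1) (b, 0) *\<^sub>R b)) (at t within {0..})"
    by (rule has_vector_derivative_transform[OF _ _ sum_deriv]) (use t nabla_x in auto)
  then show "(nabla_x f x has_vector_derivative nabla_xt f x t) (at t within {0..})"
    using vector_derivative_within[OF at_within_Ici_neq_bot[OF t] nabla_x_deriv]
    by (simp add: nabla_xt_def)
qed

lemma vector_derivative_bound_imp_lipschitz:
  fixes u :: "real \<Rightarrow> 'b::real_normed_vector"
  assumes "convex S" and "a \<in> S" and "b \<in> S"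
    and der: "\<And>s. s \<in> S \<Longrightarrow> (u has_vector_derivative u' s) (at s within S)"
    and bound: "\<And>s. s \<in> S \<Longrightarrow> norm (u' s) \<le> B"
  shows "norm (u b - u a) \<le> B * \<bar>b - a\<bar>"
proof -
  have "norm (u b - u a) \<le> B * norm (b - a)"
  proof (rule differentiable_bound[OF \<open>convex S\<close>])
    show "(u has_derivative (\<lambda>h. h *\<^sub>R u' s)) (at s within S)" if "s \<in> S" for s
      using der[OF that] by (simp add: has_vector_derivative_def)
    show "onorm (\<lambda>h. h *\<^sub>R u' s) \<le> B" if "s \<in> S" for s
      using bound[OF that] by (simp add: onorm_scaleR_left onorm_id)
  qed (use assms in auto)
  then show ?thesis
    by simp
qed

lemma space_derivative:
  fixes f :: "'a::euclidean_space \<Rightarrow> real \<Rightarrow> real"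
  assumes "strong_convexity f m" and "t \<ge> 0"
  shows "((\<lambda>y. f y t) has_derivative (\<lambda>v. nabla_x f x t \<bullet> v)) (at x)"
proof -
  have "twice_cont_diff_on UNIV (\<lambda>y. f y t)"
    using assms by (simp add: strong_convexity_def)
  then obtain F' :: "'a \<Rightarrow> 'a \<Rightarrow>\<^sub>L real" where "((\<lambda>y. f y t) has_derivative F' x) (at x)"
    unfolding twice_cont_diff_on_def by auto
  then show ?thesis
    unfolding nabla_x_def by (rule grad_works(1))
qed

section \<open>Consequences of strong convexity and of the Lipschitz gradient\<close>

lemma strong_convexity_lower_bound:
  fixes f :: "'a::euclidean_space \<Rightarrow> real \<Rightarrow> real"
  assumes sc: "strong_convexity f m" and t: "t \<ge> 0"
  shows "f x t + nabla_x f x t \<bullet> (y - x) + m / 2 * (norm (y - x))\<^sup>2 \<le> f y t"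
proof -
  have der: "((\<lambda>z. - f z t) has_derivative (\<lambda>v. - nabla_x f z t \<bullet> v)) (at z)" for z
    using has_derivative_minus[OF space_derivative[OF sc t]] by simp
  have "(z - x) \<bullet> (- nabla_x f z t - - nabla_x f x t) \<le> - m * (norm (z - x))\<^sup>2" for z
  proof -
    have "m * (norm (z - x))\<^sup>2 \<le> (z - x) \<bullet> (nabla_x f z t - nabla_x f x t)"
      using sc t by (simp add: strong_convexity_def)
    then show ?thesis
      by (simp add: inner_diff_right)
  qed
  then have "- f y t \<le> - f x t + (- nabla_x f x t) \<bullet> (y - x) + (- m) / 2 * (norm (y - x))\<^sup>2"
    using quadratic_upper_bound[of UNIV x y "\<lambda>z. - f z t" "\<lambda>z. - nabla_x f z t" "- m"] der
    by simp
  then show ?thesis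
    by simp
qed

lemma descent_lemma:
  fixes f :: "'a::euclidean_space \<Rightarrow> real \<Rightarrow> real"
  assumes "strong_convexity f m" and "lipschitz_gradient f M" and "t \<ge> 0"
  shows "f y t \<le> f x t + nabla_x f x t \<bullet> (y - x) + M / 2 * (norm (y - x))\<^sup>2"
  using quadratic_upper_bound[of UNIV x y "\<lambda>z. f z t" "\<lambda>z. nabla_x f z t" M]
    space_derivative[OF assms(1,3)] assms(2,3)
  by (simp add: lipschitz_gradient_def)

text \<open>
  The quadratic lower bound exceeds \<open>f 0 t\<close> outside a ball, so the minimum over that compact
  ball is global; at a minimizer the gradient vanishes, and the same bound gives uniqueness.
  Both are needed, since \<open>xstar\<close> is a definite description.
\<close>

lemma xstar_minimizer:
  fixes f :: "'a::euclidean_space \<Rightarrow> real \<Rightarrow> real"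
  assumes sc: "strong_convexity f m" and "m > 0" and t: "t \<ge> 0"
  shows "fstar f t \<le> f y t"
proof -
  define g where "g = nabla_x f 0 t"
  \<comment> \<open>The radius at which the quadratic \<open>m / 2 * r\<^sup>2\<close> overtakes the linear term \<open>norm g * r\<close>.\<close>
  define R where "R = 2 * norm g / m"
  have "R \<ge> 0"
    using \<open>m > 0\<close> by (simp add: R_def)
  have "continuous_on (cball 0 R) (\<lambda>y. f y t)"
    using space_derivative[OF sc t]
    by (meson continuous_at_imp_continuous_on has_derivative_continuous)
  with \<open>R \<ge> 0\<close> obtain x where "\<forall>y\<in>cball 0 R. f x t \<le> f y t"
    using continuous_attains_inf[of "cball 0 R" "\<lambda>y. f y t"] by auto
  then have x_min: "f x t \<le> f y t" if "norm y \<le> R" for y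
    using that by simp
  have x_glob: "f x t \<le> f y t" for y
  proof (cases "norm y \<le> R")
    case True
    then show ?thesis by (rule x_min)
  next
    case False
    have "0 \<le> norm y * (m / 2 * norm y - norm g)"
      using False \<open>m > 0\<close> by (intro mult_nonneg_nonneg) (auto simp: R_def field_simps)
    also have "\<dots> = m / 2 * (norm y)\<^sup>2 - norm g * norm y"
      by (simp add: power2_eq_square algebra_simps)
    also have "\<dots> \<le> m / 2 * (norm y)\<^sup>2 + g \<bullet> y"
      using Cauchy_Schwarz_ineq2[of g y] by linarith
    also have "\<dots> \<le> f y t - f 0 t"
      using strong_convexity_lower_bound[OF sc t, of 0 y] by (simp add: g_def)
    finally show ?thesis
      using x_min[of 0] \<open>R \<ge> 0\<close> by simp
  qed
  have "z = x" if z: "\<forall>y. f z t \<le> f y t" for z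
  proof -
    have "(\<lambda>v. nabla_x f x t \<bullet> v) = (\<lambda>v. 0)"
      using differential_zero_maxmin[of x UNIV "\<lambda>y. f y t" "\<lambda>v. nabla_x f x t \<bullet> v"]
        space_derivative[OF sc t] x_glob by auto
    then have "nabla_x f x t \<bullet> (z - x) = 0"
      by (rule fun_cong)
    then have "m / 2 * (norm (z - x))\<^sup>2 \<le> f z t - f x t"
      using strong_convexity_lower_bound[OF sc t, of x z] by simp
    also have "\<dots> \<le> 0"
      using z by simp
    finally show ?thesis
      using \<open>m > 0\<close> by (simp add: mult_le_0_iff)
  qed
  with x_glob have "xstar f t = x"
    unfolding xstar_def by (intro the_equality) auto
  then show ?thesis
    using x_glob by (simp add: fstar_def)
qed

text \<open>
  Strong convexity bounds \<open>fstar f t\<close> from below by a quadratic in the displacement \<open>d\<close>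
  from \<open>x\<close> to the minimizer; completing the square removes \<open>d\<close>.
\<close>

lemma polyak_lojasiewicz:
  fixes f :: "'a::euclidean_space \<Rightarrow> real \<Rightarrow> real"
  assumes sc: "strong_convexity f m" and "m > 0" and t: "t \<ge> 0"
  shows "2 * m * (f x t - fstar f t) \<le> (norm (nabla_x f x t))\<^sup>2"
proof -
  define g where "g = nabla_x f x t"
  define d where "d = xstar f t - x"
  have "f x t + g \<bullet> d + m / 2 * (norm d)\<^sup>2 \<le> fstar f t"
    using strong_convexity_lower_bound[OF sc t] by (simp add: g_def d_def fstar_def)
  then have "2 * m * (f x t + g \<bullet> d + m / 2 * (norm d)\<^sup>2) \<le> 2 * m * fstar f t"
    using \<open>m > 0\<close> by (intro mult_left_mono) auto
  moreover have "(norm (g + m *\<^sub>R d))\<^sup>2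
      = (norm g)\<^sup>2 + 2 * m * (g \<bullet> d) + m\<^sup>2 * (norm d)\<^sup>2"
    by (simp add: power2_norm_eq_inner inner_add_left inner_add_right inner_commute)
      (simp add: power2_eq_square algebra_simps)
  then have "0 \<le> (norm g)\<^sup>2 + 2 * m * (g \<bullet> d) + m\<^sup>2 * (norm d)\<^sup>2"
    by (metis zero_le_power2)
  ultimately show ?thesis
    unfolding g_def by (simp add: algebra_simps power2_eq_square)
qed

text \<open>
  Any two distinct points compare the constants, so the argument uses that a Euclidean
  space has positive dimension. The comparison makes the contraction factor \<open>1 - 2\<kappa>\<alpha>m\<close> nonnegative.
\<close>

lemma strong_convexity_le_lipschitz:
  fixes f :: "'a::euclidean_space \<Rightarrow> real \<Rightarrow> real"
  assumes "strong_convexity f m" and "lipschitz_gradient f M"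
  shows "m \<le> M"
proof -
  obtain b :: 'a where "b \<in> Basis"
    using nonempty_Basis by blast
  moreover have "m * (norm (b - 0))\<^sup>2 \<le> (b - 0) \<bullet> (nabla_x f b 0 - nabla_x f 0 0)"
    using assms(1) unfolding strong_convexity_def by blast
  moreover have "(b - 0) \<bullet> (nabla_x f b 0 - nabla_x f 0 0) \<le> M * (norm (b - 0))\<^sup>2"
    using assms(2) unfolding lipschitz_gradient_def by blast
  ultimately show ?thesis
    by simp
qed

lemma gradient_step_contraction:
  fixes f :: "'a::euclidean_space \<Rightarrow> real \<Rightarrow> real"
  assumes sc: "strong_convexity f m" and "m > 0" and lg: "lipschitz_gradient f M" and t: "t \<ge> 0"
    and "\<alpha> \<ge> 0" and \<kappa>: "\<kappa> = 1 - \<alpha> * M / 2" "\<kappa> \<ge> 0"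
  shows "f (gradient_step f \<alpha> t x) t - fstar f t \<le> (1 - 2 * \<kappa> * \<alpha> * m) * (f x t - fstar f t)"
proof -
  define g where "g = nabla_x f x t"
  have "f (gradient_step f \<alpha> t x) t \<le> f x t + g \<bullet> (- \<alpha> *\<^sub>R g) + M / 2 * (norm (- \<alpha> *\<^sub>R g))\<^sup>2"
    using descent_lemma[OF sc lg t, of "gradient_step f \<alpha> t x" x]
    by (simp add: gradient_step_def g_def)
  also have "\<dots> = f x t - \<kappa> * \<alpha> * (norm g)\<^sup>2"
    by (simp add: \<kappa>(1) power_mult_distrib power2_norm_eq_inner[symmetric])
      (simp add: algebra_simps power2_eq_square)
  finally have "f (gradient_step f \<alpha> t x) t \<le> f x t - \<kappa> * \<alpha> * (norm g)\<^sup>2" .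
  moreover have "\<kappa> * \<alpha> * (2 * m * (f x t - fstar f t)) \<le> \<kappa> * \<alpha> * (norm g)\<^sup>2"
    using polyak_lojasiewicz[OF sc \<open>m > 0\<close> t, of x] \<open>\<alpha> \<ge> 0\<close> \<kappa>(2)
    by (intro mult_left_mono) (auto simp: g_def)
  ultimately show ?thesis
    by (simp add: algebra_simps)
qed

section \<open>Drift of the objective in time\<close>

lemma value_drift:
  fixes f :: "'a::euclidean_space \<Rightarrow> real \<Rightarrow> real"
  assumes "smoothness f K1 K2 K3" and "s \<ge> 0" and "t \<ge> 0"
  shows "\<bar>f x t - f x s\<bar> \<le> K1 * \<bar>t - s\<bar>"
  using vector_derivative_bound_imp_lipschitz[of "{0..}" s t "f x" "nabla_t f x" K1]
    f_time_derivative[of f] assms by (simp add: smoothness_def)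

lemma value_drift_second_order:
  fixes f :: "'a::euclidean_space \<Rightarrow> real \<Rightarrow> real"
  assumes sm: "smoothness f K1 K2 K3" and t: "t \<ge> 0" and \<delta>: "\<delta> \<ge> 0"
  shows "f x (t + \<delta>) - f x t \<le> \<delta> * nabla_t f x t + K3 / 2 * \<delta>\<^sup>2"
proof -
  have smooth: "twice_cont_diff_on (UNIV \<times> {0..}) (\<lambda>(x, t). f x t)"
    using sm by (simp add: smoothness_def)
  have "(s - t) \<bullet> (nabla_t f x s - nabla_t f x t) \<le> K3 * (norm (s - t))\<^sup>2" if "s \<ge> 0" for s
  proof -
    have "\<bar>nabla_t f x s - nabla_t f x t\<bar> \<le> K3 * \<bar>s - t\<bar>"
      using vector_derivative_bound_imp_lipschitz[of "{0..}" t s "nabla_t f x" "nabla_tt f x" K3]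
        nabla_t_time_derivative[OF smooth] sm t that by (simp add: smoothness_def)
    then have "\<bar>s - t\<bar> * \<bar>nabla_t f x s - nabla_t f x t\<bar> \<le> \<bar>s - t\<bar> * (K3 * \<bar>s - t\<bar>)"
      by (intro mult_left_mono) auto
    moreover have "(s - t) * (nabla_t f x s - nabla_t f x t)
        \<le> \<bar>s - t\<bar> * \<bar>nabla_t f x s - nabla_t f x t\<bar>"
      by (simp flip: abs_mult)
    ultimately show ?thesis
      by (simp add: power2_eq_square algebra_simps)
  qed
  moreover have "(f x has_derivative (\<lambda>h. nabla_t f x s \<bullet> h)) (at s within {0..})" if "s \<ge> 0" for s
    using f_time_derivative[OF smooth that, of x]
    by (simp add: has_vector_derivative_def mult.commute)
  ultimately have "f x (t + \<delta>) \<le> f x t + nabla_t f x t \<bullet> (t + \<delta> - t)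
      + K3 / 2 * (norm (t + \<delta> - t))\<^sup>2"
    using t \<delta> by (intro quadratic_upper_bound[of "{0..}"]) auto
  then show ?thesis
    using \<delta> by (simp add: algebra_simps)
qed

text \<open>
  The function \<open>z \<mapsto> f z t - f z s\<close> has gradient \<open>nabla_x f z t - nabla_x f z s\<close>, whose norm is at
  most \<open>K2 \<bar>t - s\<bar>\<close> because \<open>nabla_xt\<close> is the time derivative of \<open>nabla_x\<close>. Working with
  increments instead of comparing \<open>nabla_t f\<close> at two points avoids any appeal to the symmetry of
  second derivatives, which would be delicate at the boundary \<open>t = 0\<close>.
\<close>

lemma mixed_increment_bound:
  fixes f :: "'a::euclidean_space \<Rightarrow> real \<Rightarrow> real"
  assumes sc: "strong_convexity f m" and sm: "smoothness f K1 K2 K3"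
    and s: "s \<ge> 0" and t: "t \<ge> 0"
  shows "\<bar>(f y t - f y s) - (f x t - f x s)\<bar> \<le> K2 * \<bar>t - s\<bar> * norm (y - x)"
proof -
  have "norm ((f y t - f y s) - (f x t - f x s)) \<le> K2 * \<bar>t - s\<bar> * norm (y - x)"
  proof (rule differentiable_bound[of UNIV])
    fix z
    show "((\<lambda>z. f z t - f z s) has_derivative (\<lambda>v. (nabla_x f z t - nabla_x f z s) \<bullet> v))
        (at z within UNIV)"
      using has_derivative_diff[OF space_derivative[OF sc t] space_derivative[OF sc s]]
      by (simp add: inner_diff_left)
    have "norm (nabla_x f z t - nabla_x f z s) \<le> K2 * \<bar>t - s\<bar>"
      using vector_derivative_bound_imp_lipschitz[of "{0..}" s t "nabla_x f z" "nabla_xt f z" K2]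
        nabla_x_time_derivative[of f] sm s t by (simp add: smoothness_def)
    then show "onorm (\<lambda>v. (nabla_x f z t - nabla_x f z s) \<bullet> v) \<le> K2 * \<bar>t - s\<bar>"
      by (intro onorm_le) (simp add: order_trans[OF Cauchy_Schwarz_ineq2 mult_right_mono])
  qed auto
  then show ?thesis
    by simp
qed

text \<open>
  At time \<open>s\<close> the minimizer for time \<open>t\<close> is a competitor.
\<close>

lemma fstar_drift:
  fixes f :: "'a::euclidean_space \<Rightarrow> real \<Rightarrow> real"
  assumes "strong_convexity f m" and "m > 0" and "smoothness f K1 K2 K3"
    and "s \<ge> 0" and "t \<ge> 0"
  shows "fstar f s - fstar f t \<le> K1 * \<bar>t - s\<bar>"
  using xstar_minimizer[OF assms(1,2,4), of "xstar f t"] value_drift[OF assms(3-5), of "xstar f t"]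
  by (simp add: fstar_def)

section \<open>The prediction step\<close>

text \<open>
  Both moving branches of the prediction displace \<open>x\<close> along some \<open>d\<close> with \<open>norm d \<ge> \<epsilon>\<close>. If
  \<open>d\<close> were the gradient, the first-order decrease would be exactly \<open>\<delta> \<bar>nabla_t f x t\<bar>\<close>, which
  balances the first-order increase in time; the number \<open>L\<close> measures by how much the direction
  \<open>d\<close> deviates from the gradient, relative to \<open>\<delta>\<close>. What remains is quadratic in
  \<open>\<delta>\<close>, as the displacement has length at most \<open>\<delta> K1 / \<epsilon>\<close>.
\<close>

lemma predicted_step_bound:
  fixes f :: "'a::euclidean_space \<Rightarrow> real \<Rightarrow> real"
  assumes sc: "strong_convexity f m" and lg: "lipschitz_gradient f M"
    and sm: "smoothness f K1 K2 K3"
    and nonneg: "M \<ge> 0" "K1 \<ge> 0" "K2 \<ge> 0" "\<epsilon> > 0" "\<delta> \<ge> 0" "t \<ge> 0"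
    and d: "norm d \<ge> \<epsilon>"
    and y: "y = x - (\<delta> * \<bar>nabla_t f x t\<bar> / (norm d)\<^sup>2) *\<^sub>R d"
    and along: "nabla_x f x t \<bullet> d \<ge> (norm d)\<^sup>2 - \<delta> * L * norm d" and "L \<ge> 0"
  shows "f y (t + \<delta>) - f x t
    \<le> (K3 / 2 + K1 * (K2 + L) / \<epsilon> + M * K1\<^sup>2 / (2 * \<epsilon>\<^sup>2)) * \<delta>\<^sup>2"
proof -
  define a where "a = \<bar>nabla_t f x t\<bar>"
  define r where "r = \<delta> * a / norm d"
  define \<sigma> where "\<sigma> = \<delta> * a / (norm d)\<^sup>2"
  have a: "0 \<le> a" "a \<le> K1"
    using sm \<open>t \<ge> 0\<close> by (auto simp: a_def smoothness_def)
  have dpos: "norm d > 0"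
    using d \<open>\<epsilon> > 0\<close> by linarith
  have \<sigma>: "\<sigma> \<ge> 0" "\<sigma> * norm d = r" "\<sigma> * (norm d)\<^sup>2 = \<delta> * a"
    using dpos a \<open>\<delta> \<ge> 0\<close> by (auto simp: \<sigma>_def r_def power2_eq_square)
  have r: "0 \<le> r" "r \<le> \<delta> * K1 / \<epsilon>"
    unfolding r_def using a d dpos nonneg by (auto intro!: frac_le mult_left_mono)
  have step: "y - x = - (\<sigma> *\<^sub>R d)"
    by (simp add: y \<sigma>_def a_def)
  have norm_step: "norm (y - x) = r"
    using \<sigma> by (simp add: step)
  have "\<sigma> * ((norm d)\<^sup>2 - \<delta> * L * norm d) \<le> \<sigma> * (nabla_x f x t \<bullet> d)"
    using along \<sigma>(1) by (rule mult_left_mono)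
  moreover have "\<sigma> * ((norm d)\<^sup>2 - \<delta> * L * norm d) = \<delta> * a - \<delta> * L * r"
    using \<sigma>(2,3) by (simp add: algebra_simps)
  ultimately have "f y t \<le> f x t - \<delta> * a + \<delta> * L * r + M / 2 * r\<^sup>2"
    using descent_lemma[OF sc lg \<open>t \<ge> 0\<close>, of y x] norm_step by (simp add: step)
  moreover have "f y (t + \<delta>) - f y t \<le> f x (t + \<delta>) - f x t + K2 * \<delta> * r"
    using mixed_increment_bound[OF sc sm \<open>t \<ge> 0\<close>, of "t + \<delta>" y x] nonneg norm_step by simp
  moreover have "f x (t + \<delta>) - f x t \<le> \<delta> * a + K3 / 2 * \<delta>\<^sup>2"
    using value_drift_second_order[OF sm \<open>t \<ge> 0\<close> \<open>\<delta> \<ge> 0\<close>, of x]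
      mult_left_mono[OF abs_ge_self[of "nabla_t f x t"] \<open>\<delta> \<ge> 0\<close>] by (simp add: a_def)
  ultimately have "f y (t + \<delta>) - f x t \<le> K3 / 2 * \<delta>\<^sup>2 + \<delta> * (K2 + L) * r + M / 2 * r\<^sup>2"
    by (simp add: algebra_simps)
  also have "\<dots> \<le> K3 / 2 * \<delta>\<^sup>2 + \<delta> * (K2 + L) * (\<delta> * K1 / \<epsilon>) + M / 2 * (\<delta> * K1 / \<epsilon>)\<^sup>2"
    using r nonneg \<open>L \<ge> 0\<close> by (intro add_mono mult_left_mono power_mono order_refl) auto
  also have "\<dots> = (K3 / 2 + K1 * (K2 + L) / \<epsilon> + M * K1\<^sup>2 / (2 * \<epsilon>\<^sup>2)) * \<delta>\<^sup>2"
    by (simp add: field_simps power2_eq_square)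
  finally show ?thesis .
qed

text \<open>
  The direction \<open>g + \<delta> *\<^sub>R h\<close> deviates from the gradient by \<open>L = K2\<close>, the
  plain gradient by \<open>L = 0\<close>; the resting branch contributes the term linear in \<open>\<delta>\<close>.
\<close>

lemma prediction_cost:
  fixes f :: "'a::euclidean_space \<Rightarrow> real \<Rightarrow> real"
  assumes sc: "strong_convexity f m" and lg: "lipschitz_gradient f M"
    and sm: "smoothness f K1 K2 K3"
    and nonneg: "M \<ge> 0" "K1 \<ge> 0" "K2 \<ge> 0" "K3 \<ge> 0" "\<epsilon> > 0" "\<delta> \<ge> 0" "t \<ge> 0"
  shows "f (predict f \<epsilon> \<delta> t x) (t + \<delta>) - f x t
    \<le> K1 * \<delta> + (K3 / 2 + 2 * K1 * K2 / \<epsilon> + M * K1\<^sup>2 / (2 * \<epsilon>\<^sup>2)) * \<delta>\<^sup>2"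
proof -
  define g where "g = nabla_x f x t"
  define h where "h = nabla_xt f x t"
  define y where "y = predict f \<epsilon> \<delta> t x"
  note bound = predicted_step_bound[OF sc lg sm nonneg(1-3,5-7)]
  have h: "norm h \<le> K2"
    using sm \<open>t \<ge> 0\<close> by (simp add: smoothness_def h_def)
  have K1\<delta>: "0 \<le> K1 * \<delta>"
    using nonneg by simp
  consider (corrected) "norm (g + \<delta> *\<^sub>R h) \<ge> \<epsilon>"
      "y = x - (\<delta> * \<bar>nabla_t f x t\<bar> / (norm (g + \<delta> *\<^sub>R h))\<^sup>2) *\<^sub>R (g + \<delta> *\<^sub>R h)"
    | (plain) "norm g \<ge> \<epsilon>" "y = x - (\<delta> * \<bar>nabla_t f x t\<bar> / (norm g)\<^sup>2) *\<^sub>R g"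
    | (stay) "y = x"
    unfolding y_def predict_def Let_def g_def[symmetric] h_def[symmetric]
    by (cases "norm (g + \<delta> *\<^sub>R h) \<ge> \<epsilon> \<and> h \<bullet> g \<le> 0"; cases "norm g \<ge> \<epsilon>") simp_all
  then have "f y (t + \<delta>) - f x t
    \<le> K1 * \<delta> + (K3 / 2 + 2 * K1 * K2 / \<epsilon> + M * K1\<^sup>2 / (2 * \<epsilon>\<^sup>2)) * \<delta>\<^sup>2"
  proof cases
    case corrected
    define d where "d = g + \<delta> *\<^sub>R h"
    have "h \<bullet> d \<le> K2 * norm d"
      using norm_cauchy_schwarz[of h d] mult_right_mono[OF h norm_ge_zero[of d]] by linarith
    then have "\<delta> * (h \<bullet> d) \<le> \<delta> * K2 * norm d"
      using mult_left_mono[OF _ \<open>\<delta> \<ge> 0\<close>] by (simp add: mult.assoc)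
    moreover have "g \<bullet> d = (norm d)\<^sup>2 - \<delta> * (h \<bullet> d)"
      by (simp add: d_def power2_norm_eq_inner inner_add_left)
    ultimately have "g \<bullet> d \<ge> (norm d)\<^sup>2 - \<delta> * K2 * norm d"
      by linarith
    with corrected have "f y (t + \<delta>) - f x t
        \<le> (K3 / 2 + K1 * (K2 + K2) / \<epsilon> + M * K1\<^sup>2 / (2 * \<epsilon>\<^sup>2)) * \<delta>\<^sup>2"
      using nonneg by (intro bound[where d = d]) (auto simp: d_def g_def)
    then show ?thesis
      using K1\<delta> by (simp add: algebra_simps)
  next
    case plain
    then have "f y (t + \<delta>) - f x t
        \<le> (K3 / 2 + K1 * (K2 + 0) / \<epsilon> + M * K1\<^sup>2 / (2 * \<epsilon>\<^sup>2)) * \<delta>\<^sup>2"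
      by (intro bound[where d = g]) (auto simp: g_def power2_norm_eq_inner)
    also have "\<dots> \<le> (K3 / 2 + 2 * K1 * K2 / \<epsilon> + M * K1\<^sup>2 / (2 * \<epsilon>\<^sup>2)) * \<delta>\<^sup>2"
      using nonneg by (intro mult_right_mono add_mono divide_right_mono) auto
    finally show ?thesis
      using K1\<delta> by linarith
  next
    case stay
    have "0 \<le> (K3 / 2 + 2 * K1 * K2 / \<epsilon> + M * K1\<^sup>2 / (2 * \<epsilon>\<^sup>2)) * \<delta>\<^sup>2"
      using nonneg by simp
    moreover have "f x (t + \<delta>) - f x t \<le> K1 * \<delta>"
      using value_drift[OF sm \<open>t \<ge> 0\<close>, of "t + \<delta>" x] nonneg by simp
    ultimately show ?thesis
      unfolding stay by linarith
  qed
  then show ?thesis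
    by (simp add: y_def)
qed

section \<open>Accumulation of the errors\<close>

lemma contraction_recursion:
  fixes e :: "nat \<Rightarrow> real"
  assumes "0 \<le> \<rho>" and "\<rho> < 1" and step: "\<And>j. e (Suc j) \<le> \<rho> * (e j + Q)"
  shows "e j \<le> \<rho> ^ j * e 0 + \<rho> * (1 - \<rho> ^ j) / (1 - \<rho>) * Q"
proof (induction j)
  case 0
  then show ?case by simp
next
  case (Suc j)
  have "e (Suc j) \<le> \<rho> * (e j + Q)"
    by (rule step)
  also have "\<dots> \<le> \<rho> * (\<rho> ^ j * e 0 + \<rho> * (1 - \<rho> ^ j) / (1 - \<rho>) * Q + Q)"
    using Suc.IH \<open>0 \<le> \<rho>\<close> by (intro mult_left_mono) auto
  also have "\<dots> = \<rho> ^ Suc j * e 0 + \<rho> * (1 - \<rho> ^ Suc j) / (1 - \<rho>) * Q"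
    using \<open>\<rho> < 1\<close> by (simp add: field_simps)
  finally show ?case .
qed

text \<open>
  After multiplication by \<open>(1 - \<rho>)\<^sup>2\<close> the left-hand side is at most \<open>1 - \<rho>\<close>, and for \<open>k \<ge> 1\<close>
  the right-hand side is at least \<open>1 - \<rho>\<close>. For \<open>k = 0\<close> the right-hand side vanishes while
  the left-hand side is \<open>\<rho>\<close>.
\<close>

lemma geometric_weight_bound:
  fixes \<rho> :: real
  assumes "0 \<le> \<rho>" and "\<rho> < 1" and "k \<ge> 1"
  shows "\<rho> * (1 - \<rho> ^ (k + 1)) / (1 - \<rho>) \<le> (1 - \<rho> ^ k) / (1 - \<rho>)\<^sup>2"
proof -
  have power_le: "\<rho> ^ k \<le> \<rho>"
    using power_decreasing[of 1 k \<rho>] assms by simp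
  have "\<rho> * (1 - \<rho> ^ (k + 1)) \<le> 1 * 1"
    using assms power_le_one[of \<rho> "k + 1"] by (intro mult_mono) auto
  then have "(1 - \<rho>) * (\<rho> * (1 - \<rho> ^ (k + 1))) \<le> (1 - \<rho>) * 1"
    using \<open>\<rho> < 1\<close> by (intro mult_left_mono) auto
  also have "\<dots> \<le> 1 - \<rho> ^ k"
    using power_le by simp
  finally have "(1 - \<rho>) * (\<rho> * (1 - \<rho> ^ (k + 1))) / (1 - \<rho>)\<^sup>2 \<le> (1 - \<rho> ^ k) / (1 - \<rho>)\<^sup>2"
    by (rule divide_right_mono) simp
  then show ?thesis
    using \<open>\<rho> < 1\<close> by (simp add: power2_eq_square)
qed

section \<open>Tracking error of the algorithm\<close>

theorem theorem4p3:
  fixes f :: "real ^ 'n \<Rightarrow> real \<Rightarrow> real"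
    and x :: "nat \<Rightarrow> real ^ 'n"
    and t f3 :: "nat \<Rightarrow> real"
    and m M K1 K2 K3 \<epsilon> \<delta> \<alpha> \<psi> \<eta> \<mu> \<gamma> \<kappa> E3 :: real
    and k :: nat
  assumes "m > 0" and "M > 0" and "K1 \<ge> 0" and "K2 \<ge> 0" and "K3 \<ge> 0"
    and "strong_convexity f m"
    and "lipschitz_gradient f M"
    and "smoothness f K1 K2 K3"
    and "\<epsilon> > 0" and "\<delta> > 0"
    and "t 0 \<ge> 0" and "\<And>j. t j = t 0 + real j * \<delta>"
    and "0 < \<alpha>" and "\<alpha> \<le> 1 / (2 * M)"
    and "algorithm3 f \<epsilon> \<delta> \<alpha> t x"
    and "\<And>j. f3 j = f (x j) (t j)"
    and "\<kappa> = 1 - \<alpha> * M / 2"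
    and "\<psi> = \<delta> * (K1 + \<delta> / 2 * K3) + K2\<^sup>2 * \<delta>\<^sup>2 / (2 * m) * (M * \<delta> / m + 2)"
    and "\<eta> = 2 / \<delta> * K1 + 1 / 2 * K3 + 2 / \<epsilon> * K1 * K2 + M / (2 * \<epsilon>\<^sup>2) * K1\<^sup>2"
    and "\<mu> = K1 + \<delta> / 2 * K3"
    and "\<gamma> = 2 / \<delta> * K1 + M / (2 * \<epsilon>\<^sup>2) * K1\<^sup>2 + 1 / 2 * K3 + 1 / \<epsilon> * K1 * K2"
    and "E3 = \<psi> / (4 * \<kappa>\<^sup>2 * \<alpha>\<^sup>2 * m)
            + max (\<gamma> * \<delta>\<^sup>2) (max (\<mu> * \<delta>) (\<eta> * \<delta>\<^sup>2)) / (4 * \<kappa>\<^sup>2 * \<alpha>\<^sup>2 * m\<^sup>2)"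
    and "k \<ge> 1"
  shows "f3 (k + 1) - fstar f (t (k + 1))
         \<le> (1 - 2 * \<kappa> * \<alpha> * m) ^ k * (f3 0 - fstar f (t 0))
            + (1 - (1 - 2 * \<kappa> * \<alpha> * m) ^ k) * E3"
proof -
  define e where "e j = f3 j - fstar f (t j)" for j
  define \<rho> where "\<rho> = 1 - 2 * \<kappa> * \<alpha> * m"
  define Q where "Q = max (\<gamma> * \<delta>\<^sup>2) (max (\<mu> * \<delta>) (\<eta> * \<delta>\<^sup>2))"
  note sc = \<open>strong_convexity f m\<close> and lg = \<open>lipschitz_gradient f M\<close>
    and sm = \<open>smoothness f K1 K2 K3\<close>
  have t_nonneg: "t j \<ge> 0" for j
    using assms(11) assms(12)[of j] \<open>\<delta> > 0\<close> by simp
  have t_Suc: "t (Suc j) = t j + \<delta>" for j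
    using assms(12)[of j] assms(12)[of "Suc j"] by (simp add: algebra_simps)
  have \<alpha>M: "0 < \<alpha> * M" "2 * (\<alpha> * M) \<le> 1"
    using \<open>M > 0\<close> \<open>0 < \<alpha>\<close> \<open>\<alpha> \<le> 1 / (2 * M)\<close> by (auto simp: field_simps)
  have \<kappa>: "0 < \<kappa>" "\<kappa> \<le> 1"
    using \<alpha>M \<open>\<kappa> = 1 - \<alpha> * M / 2\<close> by auto
  have "\<alpha> * m \<le> \<alpha> * M"
    using strong_convexity_le_lipschitz[OF sc lg] \<open>0 < \<alpha>\<close> by simp
  then have "2 * (\<alpha> * m) \<le> 1"
    using \<alpha>M by linarith
  then have "\<kappa> * (2 * (\<alpha> * m)) \<le> 1 * 1"
    using \<kappa> \<open>0 < \<alpha>\<close> \<open>m > 0\<close> by (intro mult_mono) auto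
  moreover have "0 < \<kappa> * (2 * (\<alpha> * m))"
    using \<kappa> \<open>0 < \<alpha>\<close> \<open>m > 0\<close> by simp
  ultimately have \<rho>: "0 \<le> \<rho>" "\<rho> < 1"
    by (auto simp: \<rho>_def algebra_simps)
  have e_step: "e (Suc j) \<le> \<rho> * (e j + Q)" for j
  proof -
    define y where "y = predict f \<epsilon> \<delta> (t j) (x j)"
    have "x (Suc j) = gradient_step f \<alpha> (t (Suc j)) y"
      using \<open>algorithm3 f \<epsilon> \<delta> \<alpha> t x\<close> by (simp add: algorithm3_def y_def)
    then have contract: "e (Suc j) \<le> \<rho> * (f y (t (Suc j)) - fstar f (t (Suc j)))"
      using gradient_step_contraction[OF sc \<open>m > 0\<close> lg t_nonneg, where \<alpha> = \<alpha> and \<kappa> = \<kappa>]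
        \<kappa> \<open>0 < \<alpha>\<close> assms(16,17) by (simp add: e_def \<rho>_def)
    have "f y (t (Suc j)) - f (x j) (t j)
        \<le> K1 * \<delta> + (K3 / 2 + 2 * K1 * K2 / \<epsilon> + M * K1\<^sup>2 / (2 * \<epsilon>\<^sup>2)) * \<delta>\<^sup>2"
      unfolding y_def t_Suc using assms(1-10) t_nonneg
      by (intro prediction_cost[OF sc lg sm]) auto
    moreover have "fstar f (t j) - fstar f (t (Suc j)) \<le> K1 * \<delta>"
      using fstar_drift[OF sc \<open>m > 0\<close> sm t_nonneg[of j] t_nonneg[of "Suc j"]] \<open>\<delta> > 0\<close>
      by (simp add: t_Suc)
    \<comment> \<open>The summand \<open>2 / \<delta> * K1\<close> of \<open>\<eta>\<close> pays once for the prediction and once for the optimum.\<close>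
    moreover have "\<eta> * \<delta>\<^sup>2 = 2 * (K1 * \<delta>)
        + (K3 / 2 + 2 * K1 * K2 / \<epsilon> + M * K1\<^sup>2 / (2 * \<epsilon>\<^sup>2)) * \<delta>\<^sup>2"
      using \<open>\<delta> > 0\<close> \<open>\<epsilon> > 0\<close> assms(19) by (simp add: field_simps power2_eq_square)
    moreover have "\<eta> * \<delta>\<^sup>2 \<le> Q"
      by (simp add: Q_def)
    ultimately have "f y (t (Suc j)) - fstar f (t (Suc j)) \<le> e j + Q"
      using assms(16) by (simp add: e_def)
    then have "\<rho> * (f y (t (Suc j)) - fstar f (t (Suc j))) \<le> \<rho> * (e j + Q)"
      using \<rho>(1) by (rule mult_left_mono)
    with contract show ?thesis
      by linarith
  qed
  have e0: "0 \<le> e 0"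
    using xstar_minimizer[OF sc \<open>m > 0\<close> t_nonneg] assms(16) by (simp add: e_def)
  have "0 \<le> \<mu> * \<delta>"
    using assms(3,5,10,20) by simp
  then have Q: "0 \<le> Q"
    by (simp add: Q_def le_max_iff_disj)
  have "0 \<le> \<psi>"
    using assms(1-5,10,18) by simp
  then have "0 \<le> \<psi> / (4 * \<kappa>\<^sup>2 * \<alpha>\<^sup>2 * m)"
    using \<open>m > 0\<close> by simp
  moreover have "4 * \<kappa>\<^sup>2 * \<alpha>\<^sup>2 * m\<^sup>2 = (1 - \<rho>)\<^sup>2"
    by (simp add: \<rho>_def power_mult_distrib)
  ultimately have E3: "Q / (1 - \<rho>)\<^sup>2 \<le> E3"
    using assms(22) by (simp add: Q_def)
  have "e (k + 1) \<le> \<rho> ^ (k + 1) * e 0 + \<rho> * (1 - \<rho> ^ (k + 1)) / (1 - \<rho>) * Q"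
    using contraction_recursion[where e = e and Q = Q, OF \<rho> e_step] .
  also have "\<dots> \<le> \<rho> ^ k * e 0 + (1 - \<rho> ^ k) / (1 - \<rho>)\<^sup>2 * Q"
    using \<rho> e0 Q \<open>k \<ge> 1\<close>
    by (intro add_mono mult_right_mono geometric_weight_bound power_decreasing) auto
  also have "\<dots> \<le> \<rho> ^ k * e 0 + (1 - \<rho> ^ k) * E3"
    using mult_left_mono[OF E3, of "1 - \<rho> ^ k"] \<rho> by (simp add: power_le_one)
  finally show ?thesis
    using assms(16) by (simp add: e_def \<rho>_def)
qed

end
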